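(* Let $L$ be a finite-dimensional semisimple Leibniz algebra over a field of characteristic zero such that $$L=(sl_2^1\oplus sl_2^2\oplus\dots\oplus sl_2^{k-1}\oplus S_k)\dot{+}I,$$ where each $sl_2^j$ is a copy of $sl_2$ and $S_k$ is a simple Lie algebra. Put $I_j=[I,sl_2^j]$ for $1\le j\le k-1$ and $I_k=[I,S_k]$. Suppose that for each $1\le j\le k-1$ the right $sl_2^j$-module $I_j$ is reducible, and write $I_j=I_{j,1}\oplus I_{j,2}\oplus\dots\oplus I_{j,p_j}$ with each $I_{j,i}$ an irreducible $sl_2^j$-module. If $\dim I_{j,r}\neq\dim I_{j,q}$ for all $1\le j\le k-1$ and all $1\le r,q\le p_j$ with $r\neq q$, then $$L=(sl_2^1\dot{+}I_1)\oplus(sl_2^2\dot{+}I_2)\oplus\dots\oplus(sl_2^{k-1}\dot{+}I_{k-1})\oplus(S_k\dot{+}I_k).$$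
   Context: A (right) Leibniz algebra is a vector space $L$ with a bilinear bracket satisfying $[x,[y,z]]=[[x,y],z]-[[x,z],y]$ for all $x,y,z\in L$. Let $I$ denote the subspace of $L$ spanned by all squares $[x,x]$, $x\in L$; it is a two-sided ideal and $L/I$ is a Lie algebra. $L$ is called semisimple if its maximal solvable ideal equals $I$. Notation: $\oplus$ is the direct sum of algebras (or of modules); $G\dot{+}I$ is the semidirect sum (vector space direct sum of the subalgebra $G$ and the ideal $I$). Here $sl_2^1\oplus\dots\oplus sl_2^{k-1}\oplus S_k$ is a Lie subalgebra of $L$, and $sl_2$ is the simple Lie algebra with basis $\{e,f,h\}$ and products $[e,h]=2e$, $[f,h]=-2f$, $[e,f]=h$ (extended antisymmetrically). The ideal $I$ and its sub-ideals are right modules over Lie subalgebras of $L$ via $(m,a)\mapsto[m,a]$. An irreducible module is a nonzero module whose only submodules are zero and itself; finite-dimensional modules over semisimple Lie algebras in characteristic zero are completely reducible. For subspaces $A,B$, $[A,B]$ is the span of all $[a,b]$ with $a\in A$, $b\in B$. *)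

theory Defs
  imports Complex_Main
begin

section \<open>Internal sums of subspaces\<close>

context vector_space
begin

definition subspace_sum :: "'b set \<Rightarrow> 'b set \<Rightarrow> 'b set" where
  "subspace_sum A B = {a + b | a b. a \<in> A \<and> b \<in> B}"

definition internal_direct_sum :: "'i set \<Rightarrow> ('i \<Rightarrow> 'b set) \<Rightarrow> 'b set \<Rightarrow> bool" where
  "internal_direct_sum J M V \<longleftrightarrow>
     finite J \<and> (\<forall>j\<in>J. subspace (M j)) \<and>
     V = {\<Sum>j\<in>J. x j | x. \<forall>j\<in>J. x j \<in> M j} \<and>
     (\<forall>x. (\<forall>j\<in>J. x j \<in> M j) \<and> (\<Sum>j\<in>J. x j) = 0 \<longrightarrow> (\<forall>j\<in>J. x j = 0))"

end

section \<open>Right Leibniz algebras\<close>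

text \<open>The algebra is the whole type \<^typ>\<open>'b\<close>; subalgebras, ideals and modules are subsets of it.\<close>

locale leibniz_algebra = vector_space scale
  for scale :: "'a::field_char_0 \<Rightarrow> 'b::ab_group_add \<Rightarrow> 'b" (infixr \<open>*s\<close> 75) +
  fixes bracket :: "'b \<Rightarrow> 'b \<Rightarrow> 'b" (\<open>\<^bold>[_,/ _\<^bold>]\<close>)
  assumes linear_left: "Vector_Spaces.linear (*s) (*s) (\<lambda>x. \<^bold>[x, y\<^bold>])"
    and linear_right: "Vector_Spaces.linear (*s) (*s) (\<lambda>y. \<^bold>[x, y\<^bold>])"
    and leibniz: "\<^bold>[x, \<^bold>[y, z\<^bold>]\<^bold>] = \<^bold>[\<^bold>[x, y\<^bold>], z\<^bold>] - \<^bold>[\<^bold>[x, z\<^bold>], y\<^bold>]"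
begin

definition product :: "'b set \<Rightarrow> 'b set \<Rightarrow> 'b set" where
  "product A B = span {\<^bold>[a, b\<^bold>] | a b. a \<in> A \<and> b \<in> B}"

definition subalgebra :: "'b set \<Rightarrow> bool" where
  "subalgebra A \<longleftrightarrow> subspace A \<and> (\<forall>x\<in>A. \<forall>y\<in>A. \<^bold>[x, y\<^bold>] \<in> A)"

definition ideal :: "'b set \<Rightarrow> 'b set \<Rightarrow> bool" where
  "ideal A J \<longleftrightarrow> subspace J \<and> J \<subseteq> A \<and> (\<forall>x\<in>J. \<forall>a\<in>A. \<^bold>[x, a\<^bold>] \<in> J \<and> \<^bold>[a, x\<^bold>] \<in> J)"

definition squares_ideal :: "'b set" where
  "squares_ideal = span {\<^bold>[x, x\<^bold>] | x. True}"

primrec derived_series :: "'b set \<Rightarrow> nat \<Rightarrow> 'b set" where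
  "derived_series A 0 = A"
| "derived_series A (Suc n) = product (derived_series A n) (derived_series A n)"

definition solvable :: "'b set \<Rightarrow> bool" where
  "solvable A \<longleftrightarrow> (\<exists>n. derived_series A n = {0})"

text \<open>The maximal solvable ideal is understood as the solvable ideal containing every solvable
  ideal.\<close>

definition semisimple :: bool where
  "semisimple \<longleftrightarrow> ideal UNIV squares_ideal \<and> solvable squares_ideal \<and>
     (\<forall>J. ideal UNIV J \<and> solvable J \<longrightarrow> J \<subseteq> squares_ideal)"

text \<open>On a subalgebra with alternating bracket the Leibniz identity is the Jacobi identity.\<close>

definition lie_subalgebra :: "'b set \<Rightarrow> bool" where
  "lie_subalgebra S \<longleftrightarrow> subalgebra S \<and> (\<forall>x\<in>S. \<^bold>[x, x\<^bold>] = 0)"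

definition simple_lie_subalgebra :: "'b set \<Rightarrow> bool" where
  "simple_lie_subalgebra S \<longleftrightarrow> lie_subalgebra S \<and> product S S \<noteq> {0} \<and>
     (\<forall>J. ideal S J \<longrightarrow> J = {0} \<or> J = S)"

definition is_sl2 :: "'b set \<Rightarrow> bool" where
  "is_sl2 S \<longleftrightarrow> (\<exists>e f h. distinct [e, f, h] \<and> independent {e, f, h} \<and> S = span {e, f, h} \<and>
     \<^bold>[e, h\<^bold>] = 2 *s e \<and> \<^bold>[h, e\<^bold>] = - (2 *s e) \<and>
     \<^bold>[f, h\<^bold>] = - (2 *s f) \<and> \<^bold>[h, f\<^bold>] = 2 *s f \<and>
     \<^bold>[e, f\<^bold>] = h \<and> \<^bold>[f, e\<^bold>] = - h \<and>
     \<^bold>[e, e\<^bold>] = 0 \<and> \<^bold>[f, f\<^bold>] = 0 \<and> \<^bold>[h, h\<^bold>] = 0)"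

text \<open>Direct sum of algebras: the summands are subalgebras annihilating each other.\<close>

definition algebra_direct_sum :: "'i set \<Rightarrow> ('i \<Rightarrow> 'b set) \<Rightarrow> 'b set \<Rightarrow> bool" where
  "algebra_direct_sum J A V \<longleftrightarrow> internal_direct_sum J A V \<and> (\<forall>j\<in>J. subalgebra (A j)) \<and>
     (\<forall>i\<in>J. \<forall>j\<in>J. i \<noteq> j \<longrightarrow> (\<forall>x\<in>A i. \<forall>y\<in>A j. \<^bold>[x, y\<^bold>] = 0))"

definition semidirect_sum :: "'b set \<Rightarrow> 'b set \<Rightarrow> 'b set \<Rightarrow> bool" where
  "semidirect_sum G J V \<longleftrightarrow>
     subalgebra G \<and> ideal V J \<and> V = subspace_sum G J \<and> G \<inter> J = {0}"

text \<open>Only modules inside the algebra, with action \<open>(m, a) \<mapsto> \<^bold>[m, a\<^bold>]\<close>, occur. The module axiom is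
  the Leibniz identity, so a module is just an invariant subspace.\<close>

definition right_module :: "'b set \<Rightarrow> 'b set \<Rightarrow> bool" where
  "right_module S M \<longleftrightarrow> subspace M \<and> (\<forall>m\<in>M. \<forall>a\<in>S. \<^bold>[m, a\<^bold>] \<in> M)"

definition irreducible_module :: "'b set \<Rightarrow> 'b set \<Rightarrow> bool" where
  "irreducible_module S M \<longleftrightarrow> right_module S M \<and> M \<noteq> {0} \<and>
     (\<forall>N. right_module S N \<and> N \<subseteq> M \<longrightarrow> N = {0} \<or> N = M)"

text \<open>Reducible means not irreducible; in particular the zero module counts as reducible.\<close>

definition reducible_module :: "'b set \<Rightarrow> 'b set \<Rightarrow> bool" where
  "reducible_module S M \<longleftrightarrow> right_module S M \<and> \<not> irreducible_module S M"

end

end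

theory Submission
  imports Defs "HOL-Computational_Algebra.Polynomial"
begin

text \<open>Right multiplication by \<open>I\<close> is zero and \<open>G\<close> is a Lie algebra, so \<open>I = I\<^sub>1 + \<dots> + I\<^sub>k\<close>; the point
  is that \<open>S\<^sub>i\<close> annihilates \<open>I\<^sub>j\<close> for \<open>i \<noteq> j\<close>.  If \<open>j < k\<close>, the elements of \<open>S\<^sub>i\<close> act on \<open>I\<^sub>j\<close> by
  \<open>sl\<^sub>2\<^sup>j\<close>-endomorphisms.  As \<open>I\<^sub>j\<close> is multiplicity free, these preserve the irreducible summands, and
  they are scalar there, since highest weight vectors exist over any field of characteristic
  zero.  So they commute, and \<open>S\<^sub>i = [S\<^sub>i, S\<^sub>i]\<close> acts by zero.  The case \<open>j = k\<close> follows from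
  \<open>[[I, S\<^sub>k], S\<^sub>i] \<subseteq> [[I, S\<^sub>i], S\<^sub>k] = 0\<close>.  The sum of the \<open>I\<^sub>j\<close> is direct because \<open>[I\<^sub>j, S\<^sub>j] = I\<^sub>j\<close> excludes
  trivial summands: an element of \<open>I\<^sub>j\<close>, \<open>j < k\<close>, lying in the sum of the others is killed by \<open>S\<^sub>j\<close>,
  hence zero.\<close>

section \<open>Annihilating polynomials and nilpotency\<close>

locale finite_dimensional_vector_space_char_0 = finite_dimensional_vector_space scale Basis
  for scale :: "'a::field_char_0 \<Rightarrow> 'b::ab_group_add \<Rightarrow> 'b" (infixr \<open>*s\<close> 75)
    and Basis :: "'b set"
begin

lemma linear_funpow:
  assumes "Vector_Spaces.linear (*s) (*s) T"
  shows "Vector_Spaces.linear (*s) (*s) (T ^^ n)"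
proof -
  interpret T: Vector_Spaces.linear "(*s)" "(*s)" T by fact
  show ?thesis
    by (induction n) (auto simp: Vector_Spaces.linear_iff vector_space_axioms T.add T.scale)
qed

text \<open>This is p(T) v, the action of the polynomial ring on the space that \<open>T\<close>
  induces.\<close>

definition eval_op :: "('b \<Rightarrow> 'b) \<Rightarrow> 'a poly \<Rightarrow> 'b \<Rightarrow> 'b" where
  "eval_op T p v = (\<Sum>i\<le>degree p. coeff p i *s (T ^^ i) v)"

text \<open>Coefficients above the degree vanish, so any common bound can replace it. Polynomials of
  different degrees, or of merely bounded degree, are compared this way.\<close>

lemma eval_op_eq:
  assumes "degree p \<le> n"
  shows "eval_op T p v = (\<Sum>i\<le>n. coeff p i *s (T ^^ i) v)"
  unfolding eval_op_def using assms by (intro sum.mono_neutral_left) (auto simp: coeff_eq_0)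

text \<open>Horner's rule; it turns the multiplicativity of evaluation into an induction over
  \<open>pCons\<close>.\<close>

lemma eval_op_pCons:
  assumes "Vector_Spaces.linear (*s) (*s) T"
  shows "eval_op T (pCons a p) v = a *s v + T (eval_op T p v)"
proof -
  interpret T: Vector_Spaces.linear "(*s)" "(*s)" T by fact
  have "eval_op T (pCons a p) v = (\<Sum>i\<le>Suc (degree p). coeff (pCons a p) i *s (T ^^ i) v)"
    by (rule eval_op_eq) (simp add: degree_pCons_le)
  also have "\<dots> = a *s v + (\<Sum>i\<le>degree p. coeff p i *s T ((T ^^ i) v))"
    by (subst sum.atMost_Suc_shift) simp
  finally show ?thesis
    by (simp add: eval_op_def T.sum T.scale)
qed

lemma eval_op_add: "eval_op T (p + q) v = eval_op T p v + eval_op T q v"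
proof -
  let ?n = "max (degree p) (degree q)"
  show ?thesis
    by (simp add: eval_op_eq[of p ?n] eval_op_eq[of q ?n] eval_op_eq[of "p + q" ?n]
        degree_add_le scale_left_distrib sum.distrib)
qed

lemma eval_op_smult: "eval_op T (smult c p) v = c *s eval_op T p v"
  using eval_op_eq[of "smult c p" "degree p" T v]
  by (simp add: eval_op_def scale_sum_right degree_smult_le)

lemma eval_op_mult:
  assumes "Vector_Spaces.linear (*s) (*s) T"
  shows "eval_op T (p * q) v = eval_op T p (eval_op T q v)"
proof (induction p)
  case 0
  show ?case by (simp add: eval_op_def)
next
  case (pCons a p)
  then show ?case
    by (simp add: eval_op_add eval_op_smult eval_op_pCons[OF assms])
qed

lemma linear_eval_op:
  assumes "Vector_Spaces.linear (*s) (*s) T"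
  shows "Vector_Spaces.linear (*s) (*s) (eval_op T p)"
proof -
  interpret T: Vector_Spaces.linear "(*s)" "(*s)" "T ^^ n" for n
    by (rule linear_funpow[OF assms])
  show ?thesis
    by (auto simp: Vector_Spaces.linear_iff vector_space_axioms eval_op_def T.add T.scale
        scale_right_distrib sum.distrib scale_sum_right mult.commute)
qed

text \<open>Among v, T v, ..., T^d v with d the dimension, either two vectors coincide, and a
  difference of two monomials works, or they form a set of d + 1 elements, and the coefficients of a
  linear dependence are those of \<open>p\<close>. The first case is separate because
  \<open>dependent\<close> speaks of sets.\<close>

lemma annihilating_poly_at:
  "\<exists>p. p \<noteq> 0 \<and> eval_op T p v = 0"
proof (cases "inj_on (\<lambda>i. (T ^^ i) v) {..dimension}")
  case False
  then obtain i j where ij: "i < j" "(T ^^ i) v = (T ^^ j) v"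
    unfolding inj_on_def by (metis linorder_neqE_nat)
  let ?p = "monom 1 i - monom 1 j :: 'a poly"
  have "coeff ?p i = 1" using ij by simp
  then have "?p \<noteq> 0" by (metis coeff_0 zero_neq_one)
  moreover have "eval_op T ?p v = 0"
  proof -
    have "degree ?p \<le> j"
      using ij by (intro degree_diff_le) (auto simp: degree_monom_eq)
    then have "eval_op T ?p v = (\<Sum>l\<le>j. coeff ?p l *s (T ^^ l) v)" by (rule eval_op_eq)
    also have "\<dots> = (\<Sum>l\<le>j. (if l = i then (T ^^ l) v else 0)) - (\<Sum>l\<le>j. (if l = j then (T ^^ l) v else 0))"
      unfolding sum_subtractf[symmetric] by (intro sum.cong) (auto simp: scale_left_diff_distrib)
    finally show ?thesis using ij by (simp add: sum.delta)
  qed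
  ultimately show ?thesis by blast
next
  case True
  let ?S = "(\<lambda>i. (T ^^ i) v) ` {..dimension}"
  have "card ?S = Suc dimension" using True by (simp add: card_image)
  then have "dependent ?S"
    using independent_card_le_dim[of ?S UNIV] by (fastforce simp: dimension_def)
  then obtain u w where u: "(\<Sum>x\<in>?S. u x *s x) = 0" "w \<in> ?S" "u w \<noteq> 0"
    using dependent_finite[of ?S] by auto
  then obtain l where l: "l \<le> dimension" "u ((T ^^ l) v) \<noteq> 0" by auto
  let ?p = "\<Sum>i\<le>dimension. monom (u ((T ^^ i) v)) i"
  have c: "coeff ?p i = (if i \<le> dimension then u ((T ^^ i) v) else 0)" for i
    by (simp add: coeff_sum sum.delta)
  then have "coeff ?p l \<noteq> 0" using l by simp
  then have "?p \<noteq> 0" by (metis coeff_0)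
  moreover have "eval_op T ?p v = 0"
  proof -
    have "degree ?p \<le> dimension"
      by (rule degree_le) (simp add: c)
    then have "eval_op T ?p v = (\<Sum>i\<le>dimension. coeff ?p i *s (T ^^ i) v)" by (rule eval_op_eq)
    also have "\<dots> = (\<Sum>i\<le>dimension. u ((T ^^ i) v) *s (T ^^ i) v)"
      by (intro sum.cong) (auto simp: c)
    also have "\<dots> = 0" using u(1) by (simp add: sum.reindex[OF True])
    finally show ?thesis .
  qed
  ultimately show ?thesis by blast
qed

text \<open>Multiply polynomials that annihilate the single basis vectors. Polynomials in
  \<open>T\<close> commute, so the factor belonging to a given vector can be applied first.\<close>

lemma annihilating_poly:
  assumes "Vector_Spaces.linear (*s) (*s) T"
  shows "\<exists>p. p \<noteq> 0 \<and> (\<forall>v. eval_op T p v = 0)"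
proof -
  have "\<exists>p. p \<noteq> 0 \<and> (\<forall>v\<in>A. eval_op T p v = 0)" if "finite A" for A
    using that
  proof (induction A rule: finite_induct)
    case empty
    show ?case by (rule exI[of _ 1]) simp
  next
    case (insert a A)
    then obtain p where p: "p \<noteq> 0" "\<forall>v\<in>A. eval_op T p v = 0" by auto
    obtain q where q: "q \<noteq> 0" "eval_op T q a = 0" using annihilating_poly_at by blast
    interpret L: Vector_Spaces.linear "(*s)" "(*s)" "eval_op T r" for r
      by (rule linear_eval_op[OF assms])
    have "eval_op T (p * q) v = 0" if "v \<in> insert a A" for v
    proof (cases "v = a")
      case True
      then show ?thesis using q by (simp add: eval_op_mult[OF assms] L.zero)
    next
      case False
      have "eval_op T (q * p) v = 0"
        using False that p by (simp add: eval_op_mult[OF assms] L.zero)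
      then show ?thesis by (simp add: mult.commute)
    qed
    then show ?case using p q by (intro exI[of _ "p * q"]) auto
  qed
  from this[OF finite_Basis] obtain p where p: "p \<noteq> 0" "\<forall>v\<in>Basis. eval_op T p v = 0" by auto
  interpret L: Vector_Spaces.linear "(*s)" "(*s)" "eval_op T p"
    by (rule linear_eval_op[OF assms])
  have "eval_op T p v = 0" for v
    using L.eq_0_on_span[of Basis v] p by (auto simp: span_Basis)
  then show ?thesis using p by blast
qed

text \<open>If \<open>p\<close> annihilates \<open>X\<close>, then so does \<open>t p'(t)\<close>, by commuting with \<open>D\<close>.  For \<open>p\<close> of minimal
  degree \<open>n\<close> this forces \<open>n p = t p'\<close>, so \<open>p\<close> is a monomial.\<close>

lemma nilpotent_if_commutator_multiple:
  assumes X: "Vector_Spaces.linear (*s) (*s) X" and D: "Vector_Spaces.linear (*s) (*s) D"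
    and comm: "\<And>v. D (X v) = X (D v) + c *s X v" and "c \<noteq> 0"
  shows "\<exists>n. \<forall>v. (X ^^ n) v = 0"
proof -
  interpret D: Vector_Spaces.linear "(*s)" "(*s)" D by fact
  interpret X: Vector_Spaces.linear "(*s)" "(*s)" X by fact
  have comm_pow: "D ((X ^^ n) v) = (X ^^ n) (D v) + (of_nat n * c) *s (X ^^ n) v" for n v
    by (induction n) (auto simp: comm X.add X.scale algebra_simps scale_left_distrib)
  define P where "P p \<longleftrightarrow> p \<noteq> 0 \<and> (\<forall>v. eval_op X p v = 0)" for p
  obtain p where p: "P p" and min: "\<And>q. P q \<Longrightarrow> degree p \<le> degree q"
    using annihilating_poly[OF X] ex_has_least_nat[of P _ degree] unfolding P_def by blast
  define n where "n = degree p"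
  have p0: "(\<Sum>i\<le>n. coeff p i *s (X ^^ i) v) = 0" for v
    using p unfolding P_def eval_op_def n_def by blast
  \<comment> \<open>This is n p - t p'. Its coefficient at \<open>n\<close> vanishes, so unless
    \<open>q = 0\<close> its degree is below \<open>n\<close>, against minimality once
    \<open>q\<close> is seen to annihilate \<open>X\<close>.\<close>
  define q where "q = smult (of_nat n) p - pCons 0 (pderiv p)"
  have cq: "coeff q i = (of_nat n - of_nat i) * coeff p i" for i
    by (cases i) (auto simp: q_def coeff_pderiv algebra_simps)
  have "eval_op X q v = 0" for v
  proof -
    \<comment> \<open>Apply \<open>D\<close> to p(X) v = 0 and subtract p(X) (D v) = 0; by
      \<open>comm_pow\<close> exactly c X p'(X) v remains.\<close>
    have "c *s (\<Sum>i\<le>n. (of_nat i * coeff p i) *s (X ^^ i) v)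
        = D (\<Sum>i\<le>n. coeff p i *s (X ^^ i) v) - (\<Sum>i\<le>n. coeff p i *s (X ^^ i) (D v))"
      by (simp add: D.sum D.scale comm_pow scale_right_distrib sum.distrib scale_sum_right mult_ac)
    then have "c *s (\<Sum>i\<le>n. (of_nat i * coeff p i) *s (X ^^ i) v) = 0"
      by (simp add: p0 D.zero)
    then have 1: "(\<Sum>i\<le>n. (of_nat i * coeff p i) *s (X ^^ i) v) = 0"
      using \<open>c \<noteq> 0\<close> by simp
    have "degree q \<le> n"
      by (rule degree_le) (auto simp: cq n_def coeff_eq_0)
    then have "eval_op X q v = (\<Sum>i\<le>n. coeff q i *s (X ^^ i) v)" by (rule eval_op_eq)
    also have "\<dots> = of_nat n *s (\<Sum>i\<le>n. coeff p i *s (X ^^ i) v)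
        - (\<Sum>i\<le>n. (of_nat i * coeff p i) *s (X ^^ i) v)"
      by (simp add: cq scale_sum_right sum_subtractf[symmetric] algebra_simps scale_left_diff_distrib)
    finally show ?thesis by (simp add: p0 1)
  qed
  moreover have "degree q < n" if "q \<noteq> 0"
  proof -
    have "degree q \<le> n"
      by (rule degree_le) (auto simp: cq n_def coeff_eq_0)
    moreover have "coeff q n = 0" by (simp add: cq)
    moreover have "coeff q (degree q) \<noteq> 0" using that by simp
    ultimately show ?thesis by (metis le_neq_implies_less)
  qed
  ultimately have "q = 0" using min[of q] unfolding P_def n_def by fastforce
  \<comment> \<open>The factor n - i in \<open>cq\<close> is nonzero for i < n in characteristic
    zero, so only the leading coefficient of \<open>p\<close> survives.\<close>
  then have c0: "coeff p i = 0" if "i < n" for i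
    using cq[of i] that by auto
  have "(X ^^ n) v = 0" for v
  proof -
    have "(\<Sum>i\<le>n. coeff p i *s (X ^^ i) v) = coeff p n *s (X ^^ n) v"
      by (subst sum.mono_neutral_right[of _ "{n}"]) (auto simp: c0)
    then show ?thesis using p0[of v] p by (auto simp: P_def n_def)
  qed
  then show ?thesis by blast
qed

end

section \<open>Irreducible modules of sl2\<close>

text \<open>A representation of sl2 in the usual left convention: [E, F] = H, [H, E] = 2E, [H, F] =
  -2F as commutators of operators. No bracket on the space itself is involved.\<close>

locale sl2_operators = finite_dimensional_vector_space_char_0 +
  fixes E F H :: "'b \<Rightarrow> 'b"
  assumes linear_E: "Vector_Spaces.linear (*s) (*s) E"
    and linear_F: "Vector_Spaces.linear (*s) (*s) F"
    and linear_H: "Vector_Spaces.linear (*s) (*s) H"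
    and EF: "E (F v) = F (E v) + H v"
    and HE: "H (E v) = E (H v) + 2 *s E v"
    and HF: "H (F v) = F (H v) - 2 *s F v"
begin

sublocale E: Vector_Spaces.linear "(*s)" "(*s)" E by (rule linear_E)
sublocale F: Vector_Spaces.linear "(*s)" "(*s)" F by (rule linear_F)
sublocale H: Vector_Spaces.linear "(*s)" "(*s)" H by (rule linear_H)

definition submodule :: "'b set \<Rightarrow> bool" where
  "submodule N \<longleftrightarrow> subspace N \<and> (\<forall>v\<in>N. E v \<in> N \<and> F v \<in> N \<and> H v \<in> N)"

definition irreducible :: "'b set \<Rightarrow> bool" where
  "irreducible M \<longleftrightarrow> submodule M \<and> M \<noteq> {0} \<and> (\<forall>N. submodule N \<and> N \<subseteq> M \<longrightarrow> N = {0} \<or> N = M)"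

lemma irreducible_eq:
  assumes "irreducible M" "submodule N" "N \<subseteq> M" "v \<in> N" "v \<noteq> 0"
  shows "N = M"
  using assms unfolding irreducible_def by blast

text \<open>\<open>H\<close> takes the role of \<open>D\<close>, with constant 2 for
  \<open>E\<close> and -2 for \<open>F\<close>; no eigenvalues of \<open>H\<close> enter.\<close>

lemma nilpotent_E: "\<exists>n. \<forall>v. (E ^^ n) v = 0"
  by (rule nilpotent_if_commutator_multiple[OF linear_E linear_H, of 2]) (auto simp: HE)

lemma nilpotent_F: "\<exists>n. \<forall>v. (F ^^ n) v = 0"
  by (rule nilpotent_if_commutator_multiple[OF linear_F linear_H, of "-2"])
    (auto simp: HF)

lemma H_F_pow: "H ((F ^^ n) v) = (F ^^ n) (H v) - (2 * of_nat n) *s (F ^^ n) v"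
proof (induction n)
  case (Suc n)
  have "H ((F ^^ Suc n) v) = F (H ((F ^^ n) v)) - 2 *s (F ^^ Suc n) v"
    by (simp add: HF)
  also have "\<dots> = (F ^^ Suc n) (H v) - ((2 * of_nat n) *s (F ^^ Suc n) v + 2 *s (F ^^ Suc n) v)"
    by (simp add: Suc F.diff F.scale)
  also have "(2 * of_nat n) *s (F ^^ Suc n) v + 2 *s (F ^^ Suc n) v
      = (2 * of_nat (Suc n)) *s (F ^^ Suc n) v"
    by (subst scale_left_distrib[symmetric]) (simp add: algebra_simps)
  finally show ?case .
qed simp

lemma linear_F_pow: "Vector_Spaces.linear (*s) (*s) (F ^^ n)"
  by (rule linear_funpow[OF linear_F])

text \<open>The classical formula [E, F^(n+1)] = (n+1) F^n (H - n), found by moving \<open>E\<close>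
  past one \<open>F\<close> at a time. The exponent \<open>Suc n\<close> avoids a power n - 1 on the
  right.\<close>

lemma E_F_pow:
  "E ((F ^^ Suc n) v) = (F ^^ Suc n) (E v) + of_nat (Suc n) *s (F ^^ n) (H v - of_nat n *s v)"
proof (induction n)
  case 0
  show ?case by (simp add: EF)
next
  case (Suc n)
  interpret P: Vector_Spaces.linear "(*s)" "(*s)" "F ^^ k" for k by (rule linear_F_pow)
  let ?u = "(F ^^ Suc n) (H v)" and ?w = "(F ^^ Suc n) v"
  have "F (E ((F ^^ Suc n) v)) = F ((F ^^ Suc n) (E v) + of_nat (Suc n) *s (F ^^ n) (H v - of_nat n *s v))"
    by (simp only: Suc.IH)
  also have "\<dots> = (F ^^ Suc (Suc n)) (E v) + of_nat (Suc n) *s (?u - of_nat n *s ?w)"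
    by (simp add: F.add F.scale F.diff P.diff P.scale del: of_nat_Suc)
  finally have IH: "F (E ((F ^^ Suc n) v)) = \<dots>" .
  have "E ((F ^^ Suc (Suc n)) v) = F (E ((F ^^ Suc n) v)) + H ((F ^^ Suc n) v)"
    by (simp add: EF)
  then have 1: "E ((F ^^ Suc (Suc n)) v) = (F ^^ Suc (Suc n)) (E v) + of_nat (Suc n) *s (?u - of_nat n *s ?w)
      + (?u - (2 * of_nat (Suc n)) *s ?w)"
    by (simp only: IH H_F_pow)
  \<comment> \<open>The coefficients add up by (n+1) n + 2 (n+1) = (n+2) (n+1).\<close>
  have 2: "of_nat (Suc n) *s (?u - of_nat n *s ?w) + (?u - (2 * of_nat (Suc n)) *s ?w)
      = of_nat (Suc (Suc n)) *s (?u - of_nat (Suc n) *s ?w)"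
  proof -
    have "of_nat (Suc n) *s (?u - of_nat n *s ?w) + (?u - (2 * of_nat (Suc n)) *s ?w)
      = (of_nat (Suc n) + 1) *s ?u - (of_nat (Suc n) * of_nat n + 2 * of_nat (Suc n)) *s ?w"
      by (simp only: scale_right_diff_distrib scale_left_distrib scale_scale scale_one) simp
    also have "(of_nat (Suc n) * of_nat n + 2 * of_nat (Suc n) :: 'a)
        = of_nat (Suc (Suc n)) * of_nat (Suc n)"
      by (simp add: algebra_simps)
    also have "(of_nat (Suc n) + 1 :: 'a) = of_nat (Suc (Suc n))" by simp
    finally show ?thesis by (simp only: scale_right_diff_distrib scale_scale)
  qed
  show ?case by (simp only: 1 2 add.assoc P.diff P.scale)
qed

text \<open>Since \<open>E\<close> is nilpotent, the sequence x, E x, E^2 x, ... of a nonzero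
  \<open>x\<close> in \<open>M\<close> has a last nonzero member.\<close>

lemma exists_killed_by_E:
  assumes "submodule M" "M \<noteq> {0}"
  obtains v where "v \<in> M" "v \<noteq> 0" "E v = 0"
proof -
  obtain x where x: "x \<in> M" "x \<noteq> 0"
    using assms by (auto simp: submodule_def dest: subspace_0)
  obtain n where n: "(E ^^ n) x = 0" "\<And>m. m < n \<Longrightarrow> (E ^^ m) x \<noteq> 0"
    using nilpotent_E exists_least_iff[of "\<lambda>n. (E ^^ n) x = 0"] by auto
  then obtain m where m: "n = Suc m" using x by (cases n) auto
  have "(E ^^ i) x \<in> M" for i
    using assms x by (induction i) (auto simp: submodule_def)
  then show ?thesis using n m by (intro that[of "(E ^^ m) x"]) auto
qed

text \<open>The eigenvalue exists without assuming the field algebraically closed: a vector of \<open>ker E\<close>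
  killed by the least possible power \<open>F\<^sup>s\<^sup>+\<^sup>1\<close> satisfies \<open>0 = E F\<^sup>s\<^sup>+\<^sup>1 v = (s + 1) F\<^sup>s (H - s) v\<close>, whence
  \<open>H v = s v\<close> by minimality.\<close>

lemma exists_highest_weight_vector:
  assumes "submodule M" "M \<noteq> {0}"
  obtains w \<mu> where "w \<in> M" "w \<noteq> 0" "E w = 0" "H w = \<mu> *s w"
proof -
  define P where "P n \<longleftrightarrow> (\<exists>v\<in>M. v \<noteq> 0 \<and> E v = 0 \<and> (F ^^ n) v = 0)" for n
  have "\<exists>n. P n"
    using exists_killed_by_E[OF assms] nilpotent_F unfolding P_def by metis
  then obtain n where n: "P n" "\<And>m. m < n \<Longrightarrow> \<not> P m"
    using exists_least_iff[of P] by auto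
  then obtain v where v: "v \<in> M" "v \<noteq> 0" "E v = 0" "(F ^^ n) v = 0" unfolding P_def by auto
  then obtain s where s: "n = Suc s" by (cases n) auto
  interpret P: Vector_Spaces.linear "(*s)" "(*s)" "F ^^ k" for k by (rule linear_F_pow)
  let ?u = "H v - of_nat s *s v"
  have "of_nat (Suc s) *s (F ^^ s) ?u = 0"
    using E_F_pow[of s v] v(3,4) s by (simp only: E.zero P.zero) simp
  then have Fu: "(F ^^ s) ?u = 0"
    by (metis of_nat_neq_0 scale_eq_0_iff)
  have "?u \<in> M"
    using assms v(1) by (auto simp: submodule_def intro!: subspace_diff subspace_scale)
  \<comment> \<open>From E v = 0 and \<open>HE\<close> follows E (H v) = 0. So \<open>?u\<close>
    competes with \<open>v\<close> for the smaller exponent \<open>s\<close>, and minimality leaves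
    only \<open>?u = 0\<close>.\<close>
  moreover have "E ?u = 0"
    using HE[of v] v(3) by (simp add: E.diff E.scale H.zero)
  ultimately have "?u = 0"
    using Fu n(2)[of s] s unfolding P_def by auto
  then show ?thesis using v by (intro that[of v "of_nat s"]) auto
qed

text \<open>On the string w, F w, F^2 w, ... the operator \<open>H\<close> multiplies F^n w by \<mu>
  - 2n, \<open>F\<close> moves one place along, and by \<open>E_F_pow\<close> \<open>E\<close> moves
  one place back up to a factor.\<close>

lemma submodule_span_F_pow:
  assumes "E w = 0" "H w = \<mu> *s w"
  shows "submodule (span (range (\<lambda>n. (F ^^ n) w)))"
proof -
  let ?R = "range (\<lambda>n. (F ^^ n) w)"
  interpret P: Vector_Spaces.linear "(*s)" "(*s)" "F ^^ k" for k by (rule linear_F_pow)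
  have base: "(F ^^ n) w \<in> span ?R" for n by (rule span_base) auto
  have H: "H x \<in> span ?R" if "x \<in> ?R" for x
  proof -
    from that obtain n where "x = (F ^^ n) w" by auto
    then show ?thesis
      by (auto simp: H_F_pow assms(2) P.scale intro!: span_diff span_scale base)
  qed
  have F: "F x \<in> span ?R" if "x \<in> ?R" for x
  proof -
    from that obtain n where "x = (F ^^ n) w" by auto
    then show ?thesis using base[of "Suc n"] by simp
  qed
  have E: "E x \<in> span ?R" if "x \<in> ?R" for x
  proof -
    from that obtain n where n: "x = (F ^^ n) w" by auto
    show ?thesis
    proof (cases n)
      case 0
      then show ?thesis using n by (simp add: assms(1) span_zero)
    next
      case (Suc m)
      show ?thesis
        unfolding n Suc E_F_pow assms P.zero
        by (auto simp: P.diff P.scale simp del: of_nat_Suc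
            intro!: span_diff span_scale base)
    qed
  qed
  have img: "T x \<in> span ?R"
    if "Vector_Spaces.linear (*s) (*s) T" "\<And>x. x \<in> ?R \<Longrightarrow> T x \<in> span ?R" "x \<in> span ?R" for T x
  proof -
    interpret T: Vector_Spaces.linear "(*s)" "(*s)" T by fact
    have "T ` span ?R = span (T ` ?R)" by (simp add: T.span_image)
    also have "\<dots> \<subseteq> span ?R" using that(2) by (intro span_minimal) auto
    finally show ?thesis using that(3) by blast
  qed
  show ?thesis
    unfolding submodule_def
    using img[OF linear_E E] img[OF linear_F F] img[OF linear_H H] by auto
qed

text \<open>Every highest weight vector \<open>u\<close> in \<open>F M\<close> vanishes: otherwise \<open>M\<close> is spanned by the \<open>F\<^sup>n u\<close>, so
  \<open>F M = M\<close>, contradicting the nilpotency of \<open>F\<close>.\<close>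

lemma irreducible_endomorphism_scalar:
  assumes irr: "irreducible M"
    and T: "Vector_Spaces.linear (*s) (*s) T" and TM: "\<And>v. v \<in> M \<Longrightarrow> T v \<in> M"
    and TE: "\<And>v. T (E v) = E (T v)" and TF: "\<And>v. T (F v) = F (T v)"
    and TH: "\<And>v. T (H v) = H (T v)"
  obtains c where "\<And>v. v \<in> M \<Longrightarrow> T v = c *s v"
proof -
  interpret T: Vector_Spaces.linear "(*s)" "(*s)" T by fact
  have M: "submodule M" "M \<noteq> {0}" and sub: "subspace M"
    using irr by (auto simp: irreducible_def submodule_def)
  obtain w \<mu> where w: "w \<in> M" "w \<noteq> 0" "E w = 0" "H w = \<mu> *s w"
    using exists_highest_weight_vector[OF M] .
  have F_pow_M: "(F ^^ n) v \<in> M" if "v \<in> M" for v n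
    using M that by (induction n) (auto simp: submodule_def)
  \<comment> \<open>Kept general in \<open>u\<close>: it serves for \<open>w\<close> and, in the
    refutation below, for a hypothetical nonzero vector in the image F(M).\<close>
  have spans: "span (range (\<lambda>n. (F ^^ n) u)) = M"
    if "u \<in> M" "u \<noteq> 0" "E u = 0" "H u = \<mu> *s u" for u
  proof (rule irreducible_eq[OF irr submodule_span_F_pow[OF that(3,4)] _ _ that(2)])
    show "span (range (\<lambda>n. (F ^^ n) u)) \<subseteq> M"
      using F_pow_M[OF that(1)] by (intro span_minimal sub) auto
    show "u \<in> span (range (\<lambda>n. (F ^^ n) u))"
      by (rule span_base) (auto intro: image_eqI[of _ _ 0])
  qed
  have sub_FM: "subspace (F ` M)" by (rule F.subspace_image[OF sub])
  have zero: "u = 0" if "u \<in> F ` M" "E u = 0" "H u = \<mu> *s u" for u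
  proof (rule ccontr)
    assume "u \<noteq> 0"
    have uM: "u \<in> M" using that(1) M by (auto simp: submodule_def)
    have "(F ^^ n) u \<in> F ` M" for n
    proof -
      from that(1) obtain x where "u = F x" "x \<in> M" by auto
      then have "(F ^^ n) u = F ((F ^^ n) x)" by (simp add: funpow_swap1)
      then show ?thesis using F_pow_M[OF \<open>x \<in> M\<close>] by blast
    qed
    then have "span (range (\<lambda>n. (F ^^ n) u)) \<subseteq> F ` M"
      by (intro span_minimal sub_FM) auto
    then have surj: "M \<subseteq> F ` M"
      using spans[OF uM \<open>u \<noteq> 0\<close> that(2,3)] by simp
    have "M \<subseteq> (F ^^ n) ` M" for n
    proof (induction n)
      case (Suc n)
      have "M \<subseteq> F ` M" by (rule surj)
      also have "\<dots> \<subseteq> F ` (F ^^ n) ` M" using Suc by blast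
      finally show ?case by (simp add: image_comp o_def)
    qed simp
    moreover obtain n where "\<forall>v. (F ^^ n) v = 0" using nilpotent_F by blast
    ultimately show False using w(1,2) by (metis image_iff subsetD)
  qed
  \<comment> \<open>\<open>M\<close> is spanned by the F^n w, and those with n > 0 lie in F(M).
    Hence T w equals some c w up to an error in F(M).\<close>
  have "M \<subseteq> {x + y | x y. x \<in> span {w} \<and> y \<in> F ` M}" (is "_ \<subseteq> ?Q")
  proof -
    have "subspace ?Q" by (rule subspace_sums[OF subspace_span sub_FM])
    moreover have "(F ^^ n) w \<in> ?Q" for n
    proof (cases n)
      case 0
      have "w = w + 0" "w \<in> span {w}" "0 \<in> F ` M"
        using subspace_0[OF sub_FM] by (auto intro: span_base)
      then have "w \<in> ?Q" by blast
      then show ?thesis using 0 by simp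
    next
      case (Suc m)
      then have "(F ^^ n) w = 0 + F ((F ^^ m) w)" by simp
      then show ?thesis using F_pow_M[OF w(1), of m] span_zero by blast
    qed
    ultimately have "span (range (\<lambda>n. (F ^^ n) w)) \<subseteq> ?Q"
      by (intro span_minimal) auto
    then show ?thesis using spans[OF w] by simp
  qed
  then obtain x u where xu: "T w = x + u" "x \<in> span {w}" "u \<in> F ` M"
    using TM[OF w(1)] by blast
  then obtain c where c: "x = c *s w" by (auto simp: span_singleton)
  have u: "u = T w - c *s w" using xu c by simp
  \<comment> \<open>As \<open>T\<close> commutes with \<open>E\<close> and \<open>H\<close>, the
    error \<open>u\<close> is again killed by \<open>E\<close> and of weight \<mu>, so
    \<open>zero\<close> applies.\<close>
  have "E u = 0" unfolding u
    by (simp add: E.diff E.scale w(3) TE[symmetric] T.zero)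
  moreover have "H u = \<mu> *s u" unfolding u
    by (simp add: H.diff H.scale w(4) TH[symmetric] T.scale scale_right_diff_distrib mult.commute)
  ultimately have "u = 0" using zero xu by blast
  then have Tw: "T w = c *s w" using xu c by simp
  \<comment> \<open>The eigenspace of \<open>T\<close> for \<open>c\<close> is a submodule, since
    \<open>T\<close> commutes with all three operators, and it contains \<open>w\<close>.\<close>
  let ?K = "{v \<in> M. T v = c *s v}"
  have "submodule ?K"
    using M unfolding submodule_def
    by (auto simp: subspace_def T.zero T.add T.scale TE TF TH E.scale F.scale H.scale
        scale_right_distrib mult.commute)
  then have "?K = M"
    using irreducible_eq[OF irr, of ?K w] w Tw by auto
  then show ?thesis using that by blast
qed

end

section \<open>Direct sums and homomorphisms\<close>

lemma (in vector_space) subspace_sums_family: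
  assumes "\<And>j. j \<in> J \<Longrightarrow> subspace (M j)"
  shows "subspace {\<Sum>j\<in>J. x j | x. \<forall>j\<in>J. x j \<in> M j}" (is "subspace ?T")
proof (rule subspaceI)
  show "0 \<in> ?T"
    using assms by (auto intro!: exI[of _ "\<lambda>_. 0"] subspace_0)
next
  fix u v assume "u \<in> ?T" "v \<in> ?T"
  then obtain x y where "u = (\<Sum>j\<in>J. x j)" "v = (\<Sum>j\<in>J. y j)"
    and "\<forall>j\<in>J. x j \<in> M j" "\<forall>j\<in>J. y j \<in> M j" by blast
  then have "u + v = (\<Sum>j\<in>J. x j + y j)" "\<forall>j\<in>J. x j + y j \<in> M j"
    using assms by (auto simp: sum.distrib intro: subspace_add)
  then show "u + v \<in> ?T" by (intro CollectI exI[of _ "\<lambda>j. x j + y j"]) auto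
next
  fix c u assume "u \<in> ?T"
  then obtain x where "u = (\<Sum>j\<in>J. x j)" "\<forall>j\<in>J. x j \<in> M j" by blast
  then have "c *s u = (\<Sum>j\<in>J. c *s x j)" "\<forall>j\<in>J. c *s x j \<in> M j"
    using assms by (auto simp: scale_sum_right intro: subspace_scale)
  then show "c *s u \<in> ?T" by (intro CollectI exI[of _ "\<lambda>j. c *s x j"]) auto
qed

locale direct_sum_decomposition = vector_space scale
  for scale :: "'a::field \<Rightarrow> 'b::ab_group_add \<Rightarrow> 'b" (infixr \<open>*s\<close> 75) +
  fixes J :: "'i set" and M :: "'i \<Rightarrow> 'b set" and V :: "'b set"
  assumes decomposition: "internal_direct_sum J M V"
begin

text \<open>For \<open>x\<close> in \<open>V\<close> the choice is unique on \<open>J\<close> by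
  directness. Otherwise the value is arbitrary, whence the membership hypotheses below.\<close>

definition component :: "'b \<Rightarrow> 'i \<Rightarrow> 'b" where
  "component x = (SOME y. (\<forall>j\<in>J. y j \<in> M j) \<and> (\<Sum>j\<in>J. y j) = x)"

lemma finite_index: "finite J"
  and subspace_summand: "j \<in> J \<Longrightarrow> subspace (M j)"
  and sum_eq: "V = {\<Sum>j\<in>J. x j | x. \<forall>j\<in>J. x j \<in> M j}"
  using decomposition unfolding internal_direct_sum_def by auto

lemma subspace_whole: "subspace V"
  unfolding sum_eq by (rule subspace_sums_family) (rule subspace_summand)

lemma sum_eq_0D: "\<forall>j\<in>J. z j \<in> M j \<Longrightarrow> (\<Sum>j\<in>J. z j) = 0 \<Longrightarrow> \<forall>j\<in>J. z j = 0"
  using decomposition unfolding internal_direct_sum_def by blast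

lemma component:
  assumes "x \<in> V"
  shows component_in: "j \<in> J \<Longrightarrow> component x j \<in> M j"
    and sum_component: "(\<Sum>j\<in>J. component x j) = x"
proof -
  have "\<exists>y. (\<forall>j\<in>J. y j \<in> M j) \<and> (\<Sum>j\<in>J. y j) = x"
    using assms sum_eq by blast
  from someI_ex[OF this] show "j \<in> J \<Longrightarrow> component x j \<in> M j"
    and "(\<Sum>j\<in>J. component x j) = x"
    unfolding component_def by auto
qed

lemma component_sum:
  assumes y: "\<And>i. i \<in> J \<Longrightarrow> y i \<in> M i" and "j \<in> J"
  shows "component (\<Sum>i\<in>J. y i) j = y j"
proof -
  let ?x = "\<Sum>i\<in>J. y i"
  have x: "?x \<in> V" using sum_eq y by blast
  have "\<forall>j\<in>J. component ?x j - y j \<in> M j"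
    using component_in[OF x] y subspace_summand by (auto intro: subspace_diff)
  moreover have "(\<Sum>j\<in>J. component ?x j - y j) = 0"
    using sum_component[OF x] by (simp add: sum_subtractf)
  ultimately have "\<forall>j\<in>J. component ?x j - y j = 0" by (rule sum_eq_0D)
  then show ?thesis using \<open>j \<in> J\<close> by auto
qed

lemma component_add:
  assumes "x \<in> V" "y \<in> V" "j \<in> J"
  shows "component (x + y) j = component x j + component y j"
proof -
  have "component (\<Sum>i\<in>J. component x i + component y i) j
      = component x j + component y j"
    using assms component_in subspace_summand
    by (intro component_sum) (auto intro: subspace_add)
  then show ?thesis using assms by (simp add: sum.distrib sum_component)
qed

text \<open>Applying \<open>T\<close> to each term of the decomposition of \<open>x\<close> gives a
  decomposition of \<open>T x\<close>, and components are unique. It is used for scalars and for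
  right multiplications that preserve the summands.\<close>

lemma component_commute:
  assumes T: "Vector_Spaces.linear (*s) (*s) T"
    and inv: "\<And>i y. i \<in> J \<Longrightarrow> y \<in> M i \<Longrightarrow> T y \<in> M i"
    and "x \<in> V" "j \<in> J"
  shows "component (T x) j = T (component x j)"
proof -
  interpret T: Vector_Spaces.linear "(*s)" "(*s)" T by (rule T)
  have "component (\<Sum>i\<in>J. T (component x i)) j = T (component x j)"
    using assms component_in by (intro component_sum) auto
  then show ?thesis using assms by (simp add: sum_component flip: T.sum)
qed

lemma component_scale:
  assumes "x \<in> V" "j \<in> J"
  shows "component (c *s x) j = c *s component x j"
  by (rule component_commute[OF linear_scale_self])
    (use assms subspace_summand in \<open>auto intro: subspace_scale\<close>)

lemma component_summand:
  assumes "x \<in> M j" "j \<in> J"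
  shows "component x j = x" and "x \<in> V"
proof -
  let ?y = "\<lambda>i. if i = j then x else 0"
  have x: "(\<Sum>i\<in>J. ?y i) = x" and y: "\<And>i. i \<in> J \<Longrightarrow> ?y i \<in> M i"
    using assms finite_index subspace_summand by (auto intro: subspace_0)
  from y show "component x j = x"
    using component_sum[of ?y j] assms(2) x by simp
  show "x \<in> V"
    unfolding sum_eq using x[symmetric] y by blast
qed

end

text \<open>The map is linear on \<open>M\<close> only. The linear extension \<open>g\<close> of its
  values on a basis of \<open>M\<close> agrees with it on \<open>M\<close>, and injective linear
  maps preserve dimension.\<close>

lemma (in finite_dimensional_vector_space) dim_eq_if_linear_bij_on:
  assumes M: "subspace M" and inj: "inj_on \<phi> M"
    and add: "\<And>x y. x \<in> M \<Longrightarrow> y \<in> M \<Longrightarrow> \<phi> (x + y) = \<phi> x + \<phi> y"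
    and scale: "\<And>c x. x \<in> M \<Longrightarrow> \<phi> (c *s x) = c *s \<phi> x"
  shows "dim (\<phi> ` M) = dim M"
proof -
  interpret finite_dimensional_vector_space_pair_1 scale Basis scale
    by unfold_locales
  obtain A where A: "A \<subseteq> M" "independent A" "M \<subseteq> span A"
    using basis_exists[of M] by metis
  define g where "g = construct A \<phi>"
  have g: "Vector_Spaces.linear (*s) (*s) g"
    unfolding g_def by (rule linear_construct[OF A(2)])
  interpret g: Vector_Spaces.linear "(*s)" "(*s)" g by (rule g)
  have \<phi>0: "\<phi> 0 = 0"
    using scale[of 0 0] subspace_0[OF M] by simp
  have "subspace {x \<in> M. g x = \<phi> x}"
    unfolding subspace_def
    using M g.zero g.add g.scale add scale \<phi>0
    by (simp add: subspace_0 subspace_add subspace_scale)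
  moreover have "A \<subseteq> {x \<in> M. g x = \<phi> x}"
    using A(1) construct_basis[OF A(2)] by (auto simp: g_def)
  ultimately have "span A \<subseteq> {x \<in> M. g x = \<phi> x}" by (rule span_minimal[rotated])
  then have eq: "g x = \<phi> x" if "x \<in> M" for x using A(3) that by blast
  have "span M = M" using M by (simp only: span_eq_iff)
  then have "inj_on g (span M)"
    using inj eq unfolding inj_on_def by metis
  then have "dim (g ` M) = dim M" by (rule dim_image_eq[OF g])
  moreover have "g ` M = \<phi> ` M" by (rule image_cong) (auto simp: eq)
  ultimately show ?thesis by simp
qed

context leibniz_algebra
begin

sublocale left: Vector_Spaces.linear "(*s)" "(*s)" "\<lambda>x. \<^bold>[x, y\<^bold>]" for y
  by (rule linear_left)

sublocale right: Vector_Spaces.linear "(*s)" "(*s)" "\<lambda>y. \<^bold>[x, y\<^bold>]" for x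
  by (rule linear_right)

text \<open>By the Leibniz identity the commutator of two right multiplications is, up to sign,
  right multiplication by [a, b].\<close>

lemma bracket_right_commute:
  assumes "\<^bold>[a, b\<^bold>] = 0"
  shows "\<^bold>[\<^bold>[m, a\<^bold>], b\<^bold>] = \<^bold>[\<^bold>[m, b\<^bold>], a\<^bold>]"
  using leibniz[of m a b] assms by (simp add: right.zero)

lemma subspace_product: "subspace (product A C)"
  unfolding product_def by (rule subspace_span)

lemma bracket_in_product: "a \<in> A \<Longrightarrow> c \<in> C \<Longrightarrow> \<^bold>[a, c\<^bold>] \<in> product A C"
  unfolding product_def by (rule span_base) auto

lemma product_subset:
  assumes "subspace T" "\<And>a c. a \<in> A \<Longrightarrow> c \<in> C \<Longrightarrow> \<^bold>[a, c\<^bold>] \<in> T"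
  shows "product A C \<subseteq> T"
  unfolding product_def using assms by (intro span_minimal) auto

text \<open>Elements of \<open>S\<close> are sums of brackets, and [m, [a, b]] = [[m, a], b] -
  [[m, b], a] lies in [[A, S], S]. Later this rules out trivial summands.\<close>

lemma product_subset_if_perfect:
  assumes "product S S = S"
  shows "product A S \<subseteq> product (product A S) S"
proof (rule product_subset[OF subspace_product])
  fix m x assume "m \<in> A" "x \<in> S"
  let ?Q = "product (product A S) S"
  have "product S S \<subseteq> {x. \<^bold>[m, x\<^bold>] \<in> ?Q}"
  proof (rule product_subset)
    show "subspace {x. \<^bold>[m, x\<^bold>] \<in> ?Q}"
      using subspace_product[of "product A S" S]
      by (auto simp: subspace_def right.add right.scale right.zero)
    fix a b assume "a \<in> S" "b \<in> S"
    then show "\<^bold>[a, b\<^bold>] \<in> {x. \<^bold>[m, x\<^bold>] \<in> ?Q}"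
      using \<open>m \<in> A\<close> by (auto simp: leibniz intro!: subspace_diff[OF subspace_product] bracket_in_product)
  qed
  then show "\<^bold>[m, x\<^bold>] \<in> ?Q" using assms \<open>x \<in> S\<close> by blast
qed

text \<open>Schur's lemma: the kernel is a submodule other than \<open>M\<close>, hence zero, and
  the image is a nonzero submodule of \<open>N\<close>, hence \<open>N\<close>.\<close>

lemma dim_eq_if_nonzero_hom:
  assumes fin: "finite_dimensional_vector_space scale Basis"
    and M: "irreducible_module S M" and N: "irreducible_module S N"
    and img: "\<And>x. x \<in> M \<Longrightarrow> \<phi> x \<in> N"
    and add: "\<And>x y. x \<in> M \<Longrightarrow> y \<in> M \<Longrightarrow> \<phi> (x + y) = \<phi> x + \<phi> y"
    and scale: "\<And>c x. x \<in> M \<Longrightarrow> \<phi> (c *s x) = c *s \<phi> x"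
    and hom: "\<And>x a. x \<in> M \<Longrightarrow> a \<in> S \<Longrightarrow> \<phi> \<^bold>[x, a\<^bold>] = \<^bold>[\<phi> x, a\<^bold>]"
    and nonzero: "x0 \<in> M" "\<phi> x0 \<noteq> 0"
  shows "dim M = dim N"
proof -
  interpret finite_dimensional_vector_space scale Basis by (rule fin)
  have modM: "right_module S M" and modN: "right_module S N"
    and subM: "subspace M" and subN: "subspace N"
    using M N by (auto simp: irreducible_module_def right_module_def)
  have \<phi>0: "\<phi> 0 = 0" using scale[of 0 0] subspace_0[OF subM] by simp
  have "right_module S {x \<in> M. \<phi> x = 0}"
    using modM by (auto simp: right_module_def subspace_def add scale hom \<phi>0 left.zero)
  then have ker: "{x \<in> M. \<phi> x = 0} = {0}"
    using M nonzero unfolding irreducible_module_def by blast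
  have "subspace (\<phi> ` M)"
  proof (rule subspaceI)
    show "0 \<in> \<phi> ` M" using \<phi>0 subspace_0[OF subM] by (metis imageI)
  next
    fix u v assume "u \<in> \<phi> ` M" "v \<in> \<phi> ` M"
    then show "u + v \<in> \<phi> ` M" using add subspace_add[OF subM] by (metis (no_types) imageE imageI)
  next
    fix c u assume "u \<in> \<phi> ` M"
    then show "c *s u \<in> \<phi> ` M" using scale subspace_scale[OF subM] by (metis (no_types) imageE imageI)
  qed
  moreover have "\<forall>u\<in>\<phi> ` M. \<forall>a\<in>S. \<^bold>[u, a\<^bold>] \<in> \<phi> ` M"
    using hom modM by (auto simp: right_module_def hom[symmetric])
  ultimately have "right_module S (\<phi> ` M)" by (simp add: right_module_def)
  moreover have "\<phi> ` M \<subseteq> N" using img by blast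
  moreover have "\<phi> ` M \<noteq> {0}" using nonzero by blast
  ultimately have "\<phi> ` M = N" using N unfolding irreducible_module_def by blast
  moreover have "inj_on \<phi> M"
  proof (rule inj_onI)
    fix x y assume xy: "x \<in> M" "y \<in> M" "\<phi> x = \<phi> y"
    have d: "x - y \<in> M" using xy subM by (intro subspace_diff)
    then have "\<phi> ((x - y) + y) = \<phi> (x - y) + \<phi> y" using xy by (intro add)
    then have "\<phi> (x - y) = 0" using xy by simp
    then have "x - y = 0" using d ker by blast
    then show "x = y" by simp
  qed
  ultimately show ?thesis
    using dim_eq_if_linear_bij_on[OF subM, of \<phi>] add scale by simp
qed

end

section \<open>Perfect algebras commuting with sl2\<close>

locale finite_dimensional_leibniz_algebra =
  leibniz_algebra scale bracket + finite_dimensional_vector_space scale Basis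
  for scale :: "'a::field_char_0 \<Rightarrow> 'b::ab_group_add \<Rightarrow> 'b" (infixr \<open>*s\<close> 75)
    and bracket :: "'b \<Rightarrow> 'b \<Rightarrow> 'b" (\<open>\<^bold>[_,/ _\<^bold>]\<close>)
    and Basis :: "'b set"
begin

text \<open>Since \<open>m \<mapsto> [m, a]\<close> is a right action, the operator of \<open>f\<close> enters with a minus sign.\<close>

lemma irreducible_sl2_module_scalar:
  assumes "is_sl2 S" and irr: "irreducible_module S M"
    and comm: "\<And>b. b \<in> S \<Longrightarrow> \<^bold>[a, b\<^bold>] = 0" and inv: "\<And>m. m \<in> M \<Longrightarrow> \<^bold>[m, a\<^bold>] \<in> M"
  obtains c where "\<And>m. m \<in> M \<Longrightarrow> \<^bold>[m, a\<^bold>] = c *s m"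
proof -
  obtain e f h where S: "S = span {e, f, h}" and eh: "\<^bold>[e, h\<^bold>] = 2 *s e"
    and fh: "\<^bold>[f, h\<^bold>] = - (2 *s f)" and ef: "\<^bold>[e, f\<^bold>] = h"
    using \<open>is_sl2 S\<close> unfolding is_sl2_def by blast
  have efh: "e \<in> S" "f \<in> S" "h \<in> S"
    unfolding S by (auto intro: span_base)
  have linf: "Vector_Spaces.linear (*s) (*s) (\<lambda>m. - \<^bold>[m, f\<^bold>])"
    by (simp add: Vector_Spaces.linear_iff vector_space_axioms left.add left.scale)
  interpret A: sl2_operators scale Basis "\<lambda>m. \<^bold>[m, e\<^bold>]" "\<lambda>m. - \<^bold>[m, f\<^bold>]" "\<lambda>m. \<^bold>[m, h\<^bold>]"
  proof (intro sl2_operators.intro sl2_operators_axioms.intro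
      finite_dimensional_vector_space_char_0.intro finite_dimensional_vector_space_axioms
      linear_left linf)
    fix v
    show "\<^bold>[- \<^bold>[v, f\<^bold>], e\<^bold>] = - \<^bold>[\<^bold>[v, e\<^bold>], f\<^bold>] + \<^bold>[v, h\<^bold>]"
      using leibniz[of v e f] by (simp add: ef left.neg)
    show "\<^bold>[\<^bold>[v, e\<^bold>], h\<^bold>] = \<^bold>[\<^bold>[v, h\<^bold>], e\<^bold>] + 2 *s \<^bold>[v, e\<^bold>]"
      using leibniz[of v e h] by (simp add: eh right.scale)
    show "\<^bold>[- \<^bold>[v, f\<^bold>], h\<^bold>] = - \<^bold>[\<^bold>[v, h\<^bold>], f\<^bold>] - 2 *s - \<^bold>[v, f\<^bold>]"
      using leibniz[of v f h] by (simp add: fh right.scale right.neg left.neg algebra_simps)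
  qed
  \<comment> \<open>Invariance under \<open>e\<close>, \<open>f\<close>, \<open>h\<close> extends to
    their span \<open>S\<close> by linearity, so irreducibility over \<open>S\<close> passes to the
    three operators.\<close>
  have "right_module S N" if N: "A.submodule N" for N
  proof -
    have sub: "subspace N" using N by (simp add: A.submodule_def)
    have "\<^bold>[m, a\<^bold>] \<in> N" if m: "m \<in> N" and a: "a \<in> S" for m a
    proof -
      have "subspace {a. \<^bold>[m, a\<^bold>] \<in> N}"
        using sub by (auto simp: subspace_def right.add right.scale right.zero)
      moreover have "{e, f, h} \<subseteq> {a. \<^bold>[m, a\<^bold>] \<in> N}"
        using N m subspace_neg[OF sub, of "- \<^bold>[m, f\<^bold>]"] by (auto simp: A.submodule_def)
      ultimately have "S \<subseteq> {a. \<^bold>[m, a\<^bold>] \<in> N}" unfolding S by (rule span_minimal[rotated])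
      then show ?thesis using a by blast
    qed
    then show ?thesis using sub by (simp add: right_module_def)
  qed
  moreover have "A.submodule M"
    using irr efh by (auto simp: irreducible_module_def right_module_def A.submodule_def subspace_neg)
  ultimately have "A.irreducible M"
    using irr unfolding A.irreducible_def irreducible_module_def by blast
  then show ?thesis
  proof (rule A.irreducible_endomorphism_scalar[of M "\<lambda>m. \<^bold>[m, a\<^bold>]"])
    show "Vector_Spaces.linear (*s) (*s) (\<lambda>m. \<^bold>[m, a\<^bold>])" by (rule linear_left)
  qed (use inv that efh in \<open>auto simp: left.neg intro!: bracket_right_commute[symmetric] comm\<close>)
qed

text \<open>\<open>h\<close> is [e, f], while \<open>e\<close> and \<open>f\<close> are the halves
  of [e, h] and [h, f].\<close>

lemma sl2_perfect:
  assumes "is_sl2 S"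
  shows "product S S = S"
proof -
  obtain e f h where S: "S = span {e, f, h}"
    and br: "\<^bold>[e, h\<^bold>] = 2 *s e" "\<^bold>[h, e\<^bold>] = - (2 *s e)" "\<^bold>[f, h\<^bold>] = - (2 *s f)" "\<^bold>[h, f\<^bold>] = 2 *s f"
      "\<^bold>[e, f\<^bold>] = h" "\<^bold>[f, e\<^bold>] = - h" "\<^bold>[e, e\<^bold>] = 0" "\<^bold>[f, f\<^bold>] = 0" "\<^bold>[h, h\<^bold>] = 0"
    using assms unfolding is_sl2_def by blast
  have efh: "e \<in> S" "f \<in> S" "h \<in> S"
    unfolding S by (auto intro: span_base)
  have subS: "subspace S" by (simp add: S)
  have "\<^bold>[x, y\<^bold>] \<in> S" if "x \<in> S" "y \<in> S" for x y
  proof -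
    have *: "S \<subseteq> {y. \<^bold>[x, y\<^bold>] \<in> S}" if "x \<in> {e, f, h}" for x
    proof -
      have "subspace {y. \<^bold>[x, y\<^bold>] \<in> S}"
        using subS by (auto simp: subspace_def right.add right.scale right.zero)
      moreover have "{e, f, h} \<subseteq> {y. \<^bold>[x, y\<^bold>] \<in> S}"
        using that efh subS by (auto simp: br subspace_0 subspace_neg subspace_scale)
      ultimately have "span {e, f, h} \<subseteq> {y. \<^bold>[x, y\<^bold>] \<in> S}" by (rule span_minimal[rotated])
      then show ?thesis using S by simp
    qed
    have "subspace {x. \<^bold>[x, y\<^bold>] \<in> S}"
      using subS by (auto simp: subspace_def left.add left.scale left.zero)
    moreover have "{e, f, h} \<subseteq> {x. \<^bold>[x, y\<^bold>] \<in> S}" using * \<open>y \<in> S\<close> by blast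
    ultimately have "span {e, f, h} \<subseteq> {x. \<^bold>[x, y\<^bold>] \<in> S}" by (rule span_minimal[rotated])
    then show ?thesis using S \<open>x \<in> S\<close> by blast
  qed
  then have "product S S \<subseteq> S" by (rule product_subset[OF subS])
  moreover have "S \<subseteq> product S S"
  proof -
    have half: "x \<in> product S S" if "2 *s x \<in> product S S" for x
      using subspace_scale[OF subspace_product that, of "1/2"] by simp
    have "2 *s e \<in> product S S" "2 *s f \<in> product S S" "h \<in> product S S"
      using bracket_in_product[of e S h S] bracket_in_product[of h S f S]
        bracket_in_product[of e S f S] efh by (auto simp: br)
    then have "{e, f, h} \<subseteq> product S S" using half by blast
    then show ?thesis unfolding S by (rule span_minimal) (rule subspace_product)
  qed
  ultimately show ?thesis by blast
qed

text \<open>[S, S] is an ideal of \<open>S\<close>, nonzero by the definition of simplicity.\<close>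

lemma simple_lie_perfect:
  assumes "simple_lie_subalgebra S"
  shows "product S S = S"
proof -
  have S: "subspace S" "\<And>x y. x \<in> S \<Longrightarrow> y \<in> S \<Longrightarrow> \<^bold>[x, y\<^bold>] \<in> S"
    using assms by (auto simp: simple_lie_subalgebra_def lie_subalgebra_def subalgebra_def)
  have sub: "product S S \<subseteq> S" using S by (intro product_subset)
  have "ideal S (product S S)"
    unfolding ideal_def using sub by (auto intro: subspace_product bracket_in_product)
  then show ?thesis using assms unfolding simple_lie_subalgebra_def by blast
qed

text \<open>Composing the action of \<open>a\<close> with the projections gives homomorphisms between the summands;
  those between different summands vanish by Schur's lemma, as the dimensions differ.  So \<open>a\<close> acts on
  each summand by a scalar, and the actions of two such elements commute.\<close>

lemma commuting_perfect_acts_trivially: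
  assumes S: "is_sl2 S" and dec: "internal_direct_sum J C V"
    and irr: "\<And>r. r \<in> J \<Longrightarrow> irreducible_module S (C r)"
    and dim: "\<And>r q. r \<in> J \<Longrightarrow> q \<in> J \<Longrightarrow> r \<noteq> q \<Longrightarrow> dim (C r) \<noteq> dim (C q)"
    and comm: "\<And>a b. a \<in> S' \<Longrightarrow> b \<in> S \<Longrightarrow> \<^bold>[a, b\<^bold>] = 0"
    and inv: "\<And>m a. m \<in> V \<Longrightarrow> a \<in> S' \<Longrightarrow> \<^bold>[m, a\<^bold>] \<in> V"
    and perfect: "product S' S' = S'"
    and m: "m \<in> V" and a: "a \<in> S'"
  shows "\<^bold>[m, a\<^bold>] = 0"
proof -
  interpret D: direct_sum_decomposition scale J C V by unfold_locales (rule dec)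
  let ?P = "\<lambda>j x. D.component x j"
  note P = D.component_in D.sum_component and CV = D.component_summand(2) and fin = D.finite_index
  have modC: "\<^bold>[x, b\<^bold>] \<in> C r" if "r \<in> J" "x \<in> C r" "b \<in> S" for r x b
    using irr that by (auto simp: irreducible_module_def right_module_def)
  have off: "?P q \<^bold>[x, a\<^bold>] = 0" if rq: "r \<in> J" "q \<in> J" "r \<noteq> q" and x: "x \<in> C r" and a: "a \<in> S'" for r q x a
  proof (rule ccontr)
    assume nz: "?P q \<^bold>[x, a\<^bold>] \<noteq> 0"
    have "dim (C r) = dim (C q)"
    proof (rule dim_eq_if_nonzero_hom[OF finite_dimensional_vector_space_axioms irr irr,
          where \<phi> = "\<lambda>x. ?P q \<^bold>[x, a\<^bold>]"])
      fix y b assume "y \<in> C r" "b \<in> S"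
      \<comment> \<open>The actions of \<open>a\<close> and \<open>b\<close> commute as [a, b] = 0,
        and the projection commutes with \<open>b\<close>, which preserves every summand.\<close>
      have "\<^bold>[\<^bold>[y, b\<^bold>], a\<^bold>] = \<^bold>[\<^bold>[y, a\<^bold>], b\<^bold>]"
        using bracket_right_commute[OF comm[OF a \<open>b \<in> S\<close>]] by simp
      then show "?P q \<^bold>[\<^bold>[y, b\<^bold>], a\<^bold>] = \<^bold>[?P q \<^bold>[y, a\<^bold>], b\<^bold>]"
        using D.component_commute[OF linear_left modC inv[OF CV a] rq(2)]
          \<open>y \<in> C r\<close> \<open>b \<in> S\<close> rq(1) by simp
    qed (use rq x a nz CV inv P(1) in \<open>auto simp: left.add left.scale D.component_add D.component_scale\<close>)
    then show False using dim rq by blast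
  qed
  have invC: "\<^bold>[x, a\<^bold>] \<in> C r" if r: "r \<in> J" and x: "x \<in> C r" and a: "a \<in> S'" for r x a
  proof -
    have "\<^bold>[x, a\<^bold>] = (\<Sum>j\<in>J. ?P j \<^bold>[x, a\<^bold>])" using inv CV r x a P(2) by simp
    also have "\<dots> = ?P r \<^bold>[x, a\<^bold>]"
      using off[OF r _ _ x a] r fin by (subst sum.mono_neutral_right[of _ "{r}"]) auto
    finally show ?thesis using P(1)[OF inv[OF CV[OF x r] a] r] by simp
  qed
  have comm2: "\<^bold>[\<^bold>[x, a\<^bold>], b\<^bold>] = \<^bold>[\<^bold>[x, b\<^bold>], a\<^bold>]" if r: "r \<in> J" and x: "x \<in> C r" and ab: "a \<in> S'" "b \<in> S'"
    for r x a b
  proof -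
    obtain c d where "\<And>m. m \<in> C r \<Longrightarrow> \<^bold>[m, a\<^bold>] = c *s m" "\<And>m. m \<in> C r \<Longrightarrow> \<^bold>[m, b\<^bold>] = d *s m"
      using irreducible_sl2_module_scalar[OF S irr[OF r] comm[OF ab(1)] invC[OF r _ ab(1)]]
        irreducible_sl2_module_scalar[OF S irr[OF r] comm[OF ab(2)] invC[OF r _ ab(2)]] by metis
    then show ?thesis using x by (simp add: left.scale mult.commute)
  qed
  have "\<^bold>[x, a\<^bold>] = 0" if r: "r \<in> J" and x: "x \<in> C r" for r x
  proof -
    \<comment> \<open>Since \<open>a\<close> and \<open>b\<close> act on \<open>x\<close> in either
      order alike, [x, [a, b]] = 0, and such brackets span \<open>S'\<close>.\<close>
    have "product S' S' \<subseteq> {a. \<^bold>[x, a\<^bold>] = 0}"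
    proof (rule product_subset)
      show "subspace {a. \<^bold>[x, a\<^bold>] = 0}"
        by (auto simp: subspace_def right.add right.scale right.zero)
    qed (use comm2[OF r x] in \<open>auto simp: leibniz\<close>)
    then show ?thesis using perfect a by blast
  qed
  then have "\<^bold>[\<Sum>j\<in>J. ?P j m, a\<^bold>] = 0"
    using P(1) m by (simp add: left.sum)
  then show ?thesis using P(2)[OF m] by simp
qed

text \<open>The invariants of a summand form a submodule, hence zero or everything. If everything,
  all of [V, S] has zero component there, contradicting V \<subseteq> [V, S]. So each component of
  \<open>x\<close>, being invariant, vanishes.\<close>

lemma no_invariants:
  assumes dec: "internal_direct_sum J C V"
    and irr: "\<And>r. r \<in> J \<Longrightarrow> irreducible_module S (C r)"
    and V: "V \<subseteq> product V S"
    and x: "x \<in> V" "\<And>b. b \<in> S \<Longrightarrow> \<^bold>[x, b\<^bold>] = 0"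
  shows "x = 0"
proof -
  interpret D: direct_sum_decomposition scale J C V by unfold_locales (rule dec)
  note P = D.component_in D.sum_component
  have sub: "subspace (C r)" and modC: "y \<in> C r \<Longrightarrow> b \<in> S \<Longrightarrow> \<^bold>[y, b\<^bold>] \<in> C r"
    if "r \<in> J" for r y b
    using irr[OF that] by (auto simp: irreducible_module_def right_module_def)
  have P_bracket: "D.component \<^bold>[y, b\<^bold>] r = \<^bold>[D.component y r, b\<^bold>]"
    if "r \<in> J" "y \<in> V" "b \<in> S" for r y b
    by (rule D.component_commute[OF linear_left modC]) (use that in auto)
  have "D.component x r = 0" if r: "r \<in> J" for r
  proof -
    let ?K = "{y \<in> C r. \<forall>b\<in>S. \<^bold>[y, b\<^bold>] = 0}"
    have "right_module S ?K"
      using sub[OF r] modC[OF r]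
      by (auto simp: right_module_def subspace_def left.add left.scale left.zero)
    then have "?K = {0} \<or> ?K = C r"
      using irr[OF r] unfolding irreducible_module_def by blast
    moreover have "?K \<noteq> C r"
    proof
      assume K: "?K = C r"
      have "product V S \<subseteq> {y \<in> V. D.component y r = 0}"
      proof (rule product_subset)
        show "subspace {y \<in> V. D.component y r = 0}"
          using D.component_summand(1)[OF subspace_0[OF sub[OF r]] r] D.subspace_whole r
          by (auto simp: subspace_def D.component_add D.component_scale)
        fix y b assume yb: "y \<in> V" "b \<in> S"
        have "\<^bold>[y, b\<^bold>] = (\<Sum>j\<in>J. \<^bold>[D.component y j, b\<^bold>])"
          using P(2)[OF yb(1)] by (simp flip: left.sum)
        moreover have "\<forall>j\<in>J. \<^bold>[D.component y j, b\<^bold>] \<in> C j"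
          using modC yb P(1) by blast
        ultimately have "\<^bold>[y, b\<^bold>] \<in> V" unfolding D.sum_eq by blast
        moreover have "\<^bold>[D.component y r, b\<^bold>] = 0" using K P(1)[OF yb(1) r] yb(2) by blast
        ultimately show "\<^bold>[y, b\<^bold>] \<in> {y \<in> V. D.component y r = 0}"
          using P_bracket[OF r yb] by simp
      qed
      then have "y = 0" if "y \<in> C r" for y
        using D.component_summand[OF that r] V by auto
      then show False using irr[OF r] sub[OF r] by (auto simp: irreducible_module_def dest: subspace_0)
    qed
    moreover have "D.component x r \<in> ?K"
      using P(1)[OF x(1) r] P_bracket[OF r x(1), symmetric] x(2)
        D.component_summand(1)[OF subspace_0[OF sub[OF r]] r] by simp
    ultimately show ?thesis by blast
  qed
  then show ?thesis using P(2)[OF x(1)] by simp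
qed

end

section \<open>The decomposition\<close>

context leibniz_algebra
begin

text \<open>For y = z the right side of the Leibniz identity cancels, so [x, [y, y]] = 0; this
  extends linearly.\<close>

lemma squares_ideal_right_annihilates:
  assumes "m \<in> squares_ideal"
  shows "\<^bold>[x, m\<^bold>] = 0"
proof -
  have "squares_ideal \<subseteq> {m. \<^bold>[x, m\<^bold>] = 0}"
    unfolding squares_ideal_def
    by (intro span_minimal)
      (auto simp: leibniz subspace_def right.add right.scale right.zero)
  then show ?thesis using assms by blast
qed

end

theorem theorem3p6:
  fixes scale :: "'a::field_char_0 \<Rightarrow> 'b::ab_group_add \<Rightarrow> 'b"
    and bracket :: "'b \<Rightarrow> 'b \<Rightarrow> 'b"
    and B G :: "'b set"
    and k :: nat and S Ij :: "nat \<Rightarrow> 'b set"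
    and p :: "nat \<Rightarrow> nat" and Ic :: "nat \<Rightarrow> nat \<Rightarrow> 'b set"
  assumes "leibniz_algebra scale bracket"
    and "finite_dimensional_vector_space scale B"
    and "leibniz_algebra.semisimple scale bracket"
    and "1 \<le> k"
    and "\<And>j. 1 \<le> j \<Longrightarrow> j \<le> k - 1 \<Longrightarrow> leibniz_algebra.is_sl2 scale bracket (S j)"
    and "leibniz_algebra.simple_lie_subalgebra scale bracket (S k)"
    and "leibniz_algebra.algebra_direct_sum scale bracket {1..k} S G"
    and "leibniz_algebra.lie_subalgebra scale bracket G"
    and "leibniz_algebra.semidirect_sum scale bracket G
           (leibniz_algebra.squares_ideal scale bracket) UNIV"
    and "\<And>j. 1 \<le> j \<Longrightarrow> j \<le> k \<Longrightarrow>
           Ij j = leibniz_algebra.product scale bracket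
                    (leibniz_algebra.squares_ideal scale bracket) (S j)"
    and "\<And>j. 1 \<le> j \<Longrightarrow> j \<le> k - 1 \<Longrightarrow>
           leibniz_algebra.reducible_module scale bracket (S j) (Ij j)"
    and "\<And>j. 1 \<le> j \<Longrightarrow> j \<le> k - 1 \<Longrightarrow>
           vector_space.internal_direct_sum scale {1..p j} (Ic j) (Ij j)"
    and "\<And>j i. 1 \<le> j \<Longrightarrow> j \<le> k - 1 \<Longrightarrow> 1 \<le> i \<Longrightarrow> i \<le> p j \<Longrightarrow>
           leibniz_algebra.irreducible_module scale bracket (S j) (Ic j i)"
    and "\<And>j r q. 1 \<le> j \<Longrightarrow> j \<le> k - 1 \<Longrightarrow> 1 \<le> r \<Longrightarrow> r \<le> p j \<Longrightarrow> 1 \<le> q \<Longrightarrow> q \<le> p j \<Longrightarrow> r \<noteq> q \<Longrightarrow>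
           vector_space.dim scale (Ic j r) \<noteq> vector_space.dim scale (Ic j q)"
  shows "(\<forall>j\<in>{1..k}. leibniz_algebra.semidirect_sum scale bracket (S j) (Ij j)
             (vector_space.subspace_sum (S j) (Ij j))) \<and>
         leibniz_algebra.algebra_direct_sum scale bracket {1..k}
           (\<lambda>j. vector_space.subspace_sum (S j) (Ij j)) UNIV"
proof -
  interpret leibniz_algebra scale bracket by (rule assms(1))
  interpret finite_dimensional_vector_space scale B by (rule assms(2))
  interpret finite_dimensional_leibniz_algebra scale bracket B by unfold_locales
  note [simp] = left.zero right.zero left.add right.add left.scale right.scale
  note sl2 = assms(5) and Ij = assms(10) and Ic = assms(12) and irr = assms(13) and dims = assms(14)
  let ?K = "{1..k}" and ?I = squares_ideal and ?A = "\<lambda>j. subspace_sum (S j) (Ij j)"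

  \<comment> \<open>The summands S_j and the modules I_j\<close>
  have subS: "subspace (S j)" and brS: "x \<in> S j \<Longrightarrow> y \<in> S j \<Longrightarrow> bracket x y \<in> S j"
    and comm: "i \<in> ?K \<Longrightarrow> i \<noteq> j \<Longrightarrow> x \<in> S i \<Longrightarrow> y \<in> S j \<Longrightarrow> bracket x y = 0"
    if "j \<in> ?K" for i j x y
    using assms(7) that unfolding algebra_direct_sum_def subalgebra_def by auto
  interpret DS: direct_sum_decomposition scale ?K S G
    using assms(7) unfolding algebra_direct_sum_def by unfold_locales auto
  have I: "ideal UNIV ?I" and GI: "UNIV = subspace_sum G ?I" "G \<inter> ?I = {0}"
    using assms(9) unfolding semidirect_sum_def by auto
  have subI: "subspace ?I" and brI: "x \<in> ?I \<Longrightarrow> bracket x y \<in> ?I" for x y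
    using I unfolding ideal_def by auto
  have subG: "subspace G" by (rule DS.subspace_whole)
  note ann = squares_ideal_right_annihilates
  have SG: "S j \<subseteq> G" if "j \<in> ?K" for j
    using DS.component_summand(2)[OF _ that] by blast
  have SI: "S j \<inter> ?I \<subseteq> {0}" if "j \<in> ?K" for j using SG[OF that] GI(2) by blast
  have perfect: "product (S j) (S j) = S j" if "j \<in> ?K" for j
  proof (cases "j = k")
    case True
    then show ?thesis using simple_lie_perfect[OF assms(6)] by simp
  next
    case False
    then show ?thesis using that sl2 by (intro sl2_perfect) auto
  qed
  have subIj: "subspace (Ij j)" and IjI: "Ij j \<subseteq> ?I"
    and Ij_in: "m \<in> ?I \<Longrightarrow> a \<in> S j \<Longrightarrow> bracket m a \<in> Ij j" if "j \<in> ?K" for j m a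
    using Ij[of j] that brI product_subset[OF subI, of ?I "S j"]
    by (auto intro: subspace_product bracket_in_product)
  have Ij_inv: "bracket x b \<in> Ij j" if j: "j \<in> ?K" and i: "i \<in> ?K" and x: "x \<in> Ij j" and b: "b \<in> S i"
    for i j x b
  proof (cases "i = j")
    case True
    then show ?thesis using Ij_in IjI that by blast
  next
    case False
    \<comment> \<open>S_i and S_j commute, so [[m, a], b] = [[m, b], a], where [m, b] is still in
      I.\<close>
    have "product ?I (S j) \<subseteq> {x. bracket x b \<in> Ij j}"
    proof (rule product_subset)
      show "subspace {x. bracket x b \<in> Ij j}"
        using subIj[OF j] by (auto simp: subspace_def)
      fix m a assume m: "m \<in> ?I" and a: "a \<in> S j"
      have "bracket (bracket m a) b = bracket (bracket m b) a"
        using comm[OF i j _ a b] False by (intro bracket_right_commute) auto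
      then show "bracket m a \<in> {x. bracket x b \<in> Ij j}"
        using Ij_in[OF j brI[OF m] a] by simp
    qed
    then show ?thesis using x j Ij[of j] by auto
  qed

  \<comment> \<open>Vanishing of the action of S_i on I_j for i \<noteq> j\<close>
  have kill1: "bracket x a = 0"
    if j: "j \<in> ?K" "j \<noteq> k" and i: "i \<in> ?K" "i \<noteq> j" and x: "x \<in> Ij j" and a: "a \<in> S i" for i j x a
  proof (rule commuting_perfect_acts_trivially[of "S j" "{1..p j}" "Ic j" "Ij j" "S i"])
    have "1 \<le> j" "j \<le> k - 1" using j by auto
    then show "is_sl2 (S j)" "internal_direct_sum {1..p j} (Ic j) (Ij j)"
      by (rule sl2, rule Ic)
    show "irreducible_module (S j) (Ic j r)" if "r \<in> {1..p j}" for r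
      using j that by (intro irr) auto
    show "dim (Ic j r) \<noteq> dim (Ic j q)" if "r \<in> {1..p j}" "q \<in> {1..p j}" "r \<noteq> q" for r q
      using j that by (intro dims) auto
  qed (use j i x a comm Ij_inv perfect in auto)
  have kill: "bracket x a = 0"
    if j: "j \<in> ?K" and i: "i \<in> ?K" "i \<noteq> j" and x: "x \<in> Ij j" and a: "a \<in> S i" for i j x a
  proof (cases "j = k")
    case False
    then show ?thesis using kill1 that by blast
  next
    case True
    have "product ?I (S j) \<subseteq> {x. bracket x a = 0}"
    proof (rule product_subset)
      show "subspace {x. bracket x a = 0}" by (auto simp: subspace_def)
      fix m b assume m: "m \<in> ?I" and b: "b \<in> S j"
      have "bracket (bracket m b) a = bracket (bracket m a) b"
        using comm[OF i(1) j _ b a] i by (intro bracket_right_commute) auto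
      \<comment> \<open>The roles are exchanged: [m, a] lies in I_i with i \<noteq> k, where
        \<open>kill1\<close> already covers the action of S_k.\<close>
      also have "\<dots> = 0"
        using kill1[OF i(1) _ j _ Ij_in[OF i(1) m a] b] i True by simp
      finally show "bracket m b \<in> {x. bracket x a = 0}" by simp
    qed
    then show ?thesis using x j Ij[of j] by auto
  qed
  \<comment> \<open>I_j = [I, S_j] lies in [I_j, S_j] because S_j is perfect, so it has no nonzero
    invariants.\<close>
  have faithful: "x = 0" if j: "j \<in> ?K" "j \<noteq> k" and x: "x \<in> Ij j" "\<And>a. a \<in> S j \<Longrightarrow> bracket x a = 0" for j x
  proof (rule no_invariants[of "{1..p j}" "Ic j" "Ij j" "S j"])
    show "Ij j \<subseteq> product (Ij j) (S j)"
      using product_subset_if_perfect[OF perfect[OF j(1)], of ?I] Ij[of j] j by simp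
    show "internal_direct_sum {1..p j} (Ic j) (Ij j)" using j by (intro Ic) auto
    show "irreducible_module (S j) (Ic j r)" if "r \<in> {1..p j}" for r
      using j that by (intro irr) auto
  qed (use x in auto)

  \<comment> \<open>The subalgebras S_j + I_j\<close>
  have A_mem: "x \<in> ?A j \<longleftrightarrow> (\<exists>s m. s \<in> S j \<and> m \<in> Ij j \<and> x = s + m)" for x j
    unfolding subspace_sum_def by auto
  have subA: "subspace (?A j)" if "j \<in> ?K" for j
    unfolding subspace_sum_def by (intro subspace_sums subS subIj that)
  have IA: "Ij j \<subseteq> ?A j" if "j \<in> ?K" for j
    using subspace_0[OF subS[OF that]] A_mem by (metis add.left_neutral subsetI)
  \<comment> \<open>The terms with \<open>m'\<close> on the right vanish, since right multiplication
    by I is zero.\<close>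
  have brA: "bracket (s + m) (s' + m') = bracket s s' + bracket m s'"
    if "j \<in> ?K" "m' \<in> Ij j" for s m s' m' j
    using ann[of m'] IjI[OF that(1)] that(2) by auto
  have semi: "semidirect_sum (S j) (Ij j) (?A j)" if j: "j \<in> ?K" for j
    unfolding semidirect_sum_def
  proof (intro conjI)
    show "subalgebra (S j)" using subS[OF j] brS[OF j] by (simp add: subalgebra_def)
    show "ideal (?A j) (Ij j)"
      unfolding ideal_def
    proof (intro conjI ballI)
      fix x a assume x: "x \<in> Ij j" and "a \<in> ?A j"
      then obtain s m where a: "a = s + m" "s \<in> S j" "m \<in> Ij j" using A_mem by blast
      show "bracket x a \<in> Ij j"
        using a Ij_inv[OF j j x] ann[of m x] IjI[OF j] by auto
      show "bracket a x \<in> Ij j"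
        using ann[of x a] x IjI[OF j] subspace_0[OF subIj[OF j]] by auto
    qed (use subIj[OF j] IA[OF j] in auto)
    show "S j \<inter> Ij j = {0}"
      using SI[OF j] IjI[OF j] subspace_0[OF subS[OF j]] subspace_0[OF subIj[OF j]] by blast
  qed simp
  have subalg: "subalgebra (?A j)" if j: "j \<in> ?K" for j
    unfolding subalgebra_def
  proof (intro conjI ballI subA j)
    fix x y assume "x \<in> ?A j" "y \<in> ?A j"
    then obtain s m s' m' where *: "x = s + m" "y = s' + m'" "s \<in> S j" "s' \<in> S j" "m \<in> Ij j" "m' \<in> Ij j"
      using A_mem by metis
    then show "bracket x y \<in> ?A j"
      unfolding *(1,2) brA[OF j *(6)] A_mem using brS[OF j] Ij_inv[OF j j] by blast
  qed
  have orth: "bracket x y = 0" if ij: "i \<in> ?K" "j \<in> ?K" "i \<noteq> j" and xy: "x \<in> ?A i" "y \<in> ?A j" for i j x y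
  proof -
    obtain s m s' m' where *: "x = s + m" "y = s' + m'" "s \<in> S i" "s' \<in> S j" "m \<in> Ij i" "m' \<in> Ij j"
      using xy A_mem by metis
    then show ?thesis
      unfolding *(1,2) brA[OF ij(2) *(6)] using comm[OF ij(2,1,3)] kill[OF ij(1,2) ij(3)[symmetric]] by simp
  qed

  \<comment> \<open>Spanning: I is the sum of the I_j\<close>
  have I_sum: "?I \<subseteq> {\<Sum>j\<in>?K. x j | x. \<forall>j\<in>?K. x j \<in> Ij j}" (is "_ \<subseteq> ?T")
  proof -
    have "bracket y y \<in> ?T" for y
    proof -
      obtain g m where y: "y = g + m" "g \<in> G" "m \<in> ?I"
        using GI(1) unfolding subspace_sum_def by blast
      \<comment> \<open>Of the four terms of [g + m, g + m], [g, g] vanishes as \<open>G\<close> is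
        Lie, and two more have \<open>m\<close> on the right. Splitting \<open>g\<close> along the
        S_j then puts the square into the sum of the I_j.\<close>
      have "bracket y y = bracket m g"
        using y ann[of m] assms(8) by (simp add: lie_subalgebra_def)
      also have "\<dots> = (\<Sum>j\<in>?K. bracket m (DS.component g j))"
        using DS.sum_component[OF y(2)] by (simp flip: right.sum)
      finally show ?thesis
        using Ij_in[OF _ y(3)] DS.component_in[OF y(2)]
        by (intro CollectI exI[of _ "\<lambda>j. bracket m (DS.component g j)"]) auto
    qed
    then show ?thesis
      unfolding squares_ideal_def using subIj by (intro span_minimal subspace_sums_family) auto
  qed

  \<comment> \<open>Directness of the sum of the S_j + I_j\<close>
  have "internal_direct_sum ?K ?A UNIV"
    unfolding internal_direct_sum_def
  proof (intro conjI ballI subA allI impI)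
    show "UNIV = {\<Sum>j\<in>?K. x j | x. \<forall>j\<in>?K. x j \<in> ?A j}"
    proof (intro set_eqI iffI UNIV_I)
      fix y
      obtain g m where y: "y = g + m" "g \<in> G" "m \<in> ?I"
        using GI(1) unfolding subspace_sum_def by blast
      obtain n where n: "m = (\<Sum>j\<in>?K. n j)" "\<forall>j\<in>?K. n j \<in> Ij j" using I_sum y(3) by blast
      have "y = (\<Sum>j\<in>?K. DS.component g j + n j)"
        using y n DS.sum_component[OF y(2)] by (simp add: sum.distrib)
      moreover have "\<forall>j\<in>?K. DS.component g j + n j \<in> ?A j"
        using DS.component_in[OF y(2)] n A_mem by blast
      ultimately show "y \<in> {\<Sum>j\<in>?K. x j | x. \<forall>j\<in>?K. x j \<in> ?A j}"
        by (intro CollectI exI[of _ "\<lambda>j. DS.component g j + n j"]) auto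
    qed
  next
    fix x j assume x: "(\<forall>j\<in>?K. x j \<in> ?A j) \<and> (\<Sum>j\<in>?K. x j) = 0" and j: "j \<in> ?K"
    then have "\<forall>j\<in>?K. \<exists>s m. s \<in> S j \<and> m \<in> Ij j \<and> x j = s + m" using A_mem by blast
    then obtain s m where sm: "\<And>j. j \<in> ?K \<Longrightarrow> s j \<in> S j" "\<And>j. j \<in> ?K \<Longrightarrow> m j \<in> Ij j"
      "\<And>j. j \<in> ?K \<Longrightarrow> x j = s j + m j" by metis
    have "(\<Sum>j\<in>?K. s j) + (\<Sum>j\<in>?K. m j) = 0" using x sm(3) by (simp add: sum.distrib)
    then have eq: "(\<Sum>j\<in>?K. s j) = - (\<Sum>j\<in>?K. m j)" by (simp add: eq_neg_iff_add_eq_0)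
    \<comment> \<open>The sum of the \<open>s j\<close> lies in \<open>G\<close> and, by
      \<open>eq\<close>, in I, so it is zero; the relation splits into one for the
      \<open>s j\<close> and one for the \<open>m j\<close>.\<close>
    have "(\<Sum>j\<in>?K. s j) \<in> G" using SG sm(1) by (intro subspace_sum[OF subG]) auto
    moreover have "(\<Sum>j\<in>?K. m j) \<in> ?I"
      using IjI sm(2) by (intro subspace_sum[OF subI]) auto
    then have "(\<Sum>j\<in>?K. s j) \<in> ?I" unfolding eq by (rule subspace_neg[OF subI])
    ultimately have s0: "(\<Sum>j\<in>?K. s j) = 0" using GI(2) by blast
    then have m0: "(\<Sum>j\<in>?K. m j) = 0" using eq by simp
    have "s j = 0" using DS.sum_eq_0D[of s] s0 sm(1) j by blast
    moreover have mi: "m i = 0" if i: "i \<in> ?K" "i \<noteq> k" for i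
    proof (rule faithful[OF i sm(2)[OF i(1)]])
      fix a assume a: "a \<in> S i"
      \<comment> \<open>Bracketing the relation with \<open>a\<close> in S_i removes all terms but
        the i-th by \<open>kill\<close>, so \<open>m i\<close> is invariant under S_i.\<close>
      have "0 = (\<Sum>j\<in>?K. bracket (m j) a)" using m0 by (simp flip: left.sum)
      also have "\<dots> = bracket (m i) a"
        using i kill[OF _ i(1) _ sm(2) a] by (subst sum.mono_neutral_right[of _ "{i}"]) auto
      finally show "bracket (m i) a = 0" by simp
    qed
    moreover have "m k = 0"
    proof -
      \<comment> \<open>With the other terms gone, the relation itself reads m k = 0.\<close>
      have "(\<Sum>j\<in>?K. m j) = m k"
        using mi assms(4) by (subst sum.mono_neutral_right[of _ "{k}"]) auto
      then show ?thesis using m0 by simp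
    qed
    ultimately show "x j = 0" using sm(3)[OF j] j by (cases "j = k") auto
  qed auto
  then show ?thesis
    using semi subalg orth unfolding algebra_direct_sum_def by auto
qed

end
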